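(* Let $(w_n)_{n\ge 0}$ be positive numbers with $w_n \downarrow 0$ (that is, $w_n$ decreases monotonically to $0$). Then there exists a sequence of positive numbers $(a_n)_{n\in\mathbb{Z}}$ satisfying \[ \sum_{n\in\mathbb{Z}} a_n^2\, w_{|n|} < \infty , \] such that $(a_n)_{n\in\mathbb{Z}}$ are not the Fourier coefficients of a complex finite Borel measure on $\mathbb{T}$; that is, there is no complex finite Borel measure $\mu$ on $\mathbb{T}$ with $\widehat{\mu}(n)=a_n$ for all $n\in\mathbb{Z}$.
   Context: $\mathbb{T}$ is the unit circle in $\mathbb{C}$. For a complex finite Borel measure $\mu$ on $\mathbb{T}$, $\widehat{\mu}(n)=\int_{\mathbb{T}}\overline{\zeta}^{\,n}\,d\mu(\zeta)$, $n\in\mathbb{Z}$. *)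

theory Defs
  imports "HOL-Analysis.Analysis"
begin

text \<open>
  A complex measure on the measurable space underlying \<open>M\<close> (only \<open>space M\<close> and \<open>sets M\<close> matter)
  is a countably additive complex-valued set function on \<open>sets M\<close>. Its values are complex numbers,
  so it is automatically finite, and the empty set is sent to 0 since a constant sequence is
  summable only if it is 0. Values outside \<open>sets M\<close> are irrelevant.
\<close>

definition complex_measure :: "'a measure \<Rightarrow> ('a set \<Rightarrow> complex) \<Rightarrow> bool" where
  "complex_measure M \<mu> \<longleftrightarrow>
     (\<forall>A::nat \<Rightarrow> 'a set. range A \<subseteq> sets M \<longrightarrow> disjoint_family A \<longrightarrow>
        (\<lambda>i. \<mu> (A i)) sums \<mu> (\<Union>i. A i))"

text \<open>
  Upper variation of a signed measure \<open>\<nu>\<close>, that is, the positive part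
  \<open>E \<mapsto> sup {\<nu> F | F \<subseteq> E measurable}\<close> of its Jordan decomposition. Negative values are truncated
  to 0 by \<open>ennreal\<close>, which does not affect the supremum because \<open>F = {}\<close> contributes 0.
  The lower variation of \<open>\<nu>\<close> is the upper variation of \<open>- \<nu>\<close>.
\<close>

definition upper_variation :: "'a measure \<Rightarrow> ('a set \<Rightarrow> real) \<Rightarrow> 'a measure" where
  "upper_variation M \<nu> =
     measure_of (space M) (sets M) (\<lambda>E. SUP F\<in>{F \<in> sets M. F \<subseteq> E}. ennreal (\<nu> F))"

definition signed_integral :: "'a measure \<Rightarrow> ('a set \<Rightarrow> real) \<Rightarrow> ('a \<Rightarrow> complex) \<Rightarrow> complex" where
  "signed_integral M \<nu> f =
     integral\<^sup>L (upper_variation M \<nu>) f - integral\<^sup>L (upper_variation M (\<lambda>E. - \<nu> E)) f"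

definition complex_measure_integral ::
    "'a measure \<Rightarrow> ('a set \<Rightarrow> complex) \<Rightarrow> ('a \<Rightarrow> complex) \<Rightarrow> complex" where
  "complex_measure_integral M \<mu> f =
     signed_integral M (\<lambda>E. Re (\<mu> E)) f + \<i> * signed_integral M (\<lambda>E. Im (\<mu> E)) f"

definition circle_borel :: "complex measure" where
  "circle_borel = restrict_space borel (sphere 0 1)"

definition fourier_coeff :: "(complex set \<Rightarrow> complex) \<Rightarrow> int \<Rightarrow> complex" where
  "fourier_coeff \<mu> n = complex_measure_integral circle_borel \<mu> (\<lambda>\<zeta>. cnj \<zeta> powi n)"

text \<open>For a finite positive measure these notions are the usual ones.\<close>

lemma complex_measure_of_finite_measure:
  assumes "finite_measure N"
  shows "complex_measure N (\<lambda>E. of_real (measure N E))"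
  unfolding complex_measure_def
  by (auto intro!: sums_of_real finite_measure.finite_measure_UNION[OF assms])

lemma upper_variation_finite_measure:
  assumes "finite_measure N"
  shows "upper_variation N (measure N) = N"
proof -
  interpret finite_measure N by fact
  have "(SUP F\<in>{F \<in> sets N. F \<subseteq> E}. ennreal (measure N F)) = emeasure N E"
    if "E \<in> sets N" for E
    using that by (intro antisym SUP_least SUP_upper2[of E])
      (auto simp: emeasure_eq_measure[symmetric] intro: emeasure_mono)
  then have "upper_variation N (measure N) = measure_of (space N) (sets N) (emeasure N)"
    unfolding upper_variation_def
    by (intro measure_of_eq) (auto simp: sets.space_closed sets.sigma_sets_eq)
  then show ?thesis by (simp add: measure_of_of_measure)
qed

lemma integral_null_upper_variation:
  fixes f :: "'a \<Rightarrow> complex"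
  assumes "\<And>E. \<nu> E \<le> 0"
  shows "integral\<^sup>L (upper_variation N \<nu>) f = 0"
proof -
  have "(\<lambda>E. SUP F\<in>{F \<in> sets N. F \<subseteq> E}. ennreal (\<nu> F)) = (\<lambda>E. 0)"
    using assms by (auto simp: ennreal_neg intro!: ext antisym SUP_least)
  then have "upper_variation N \<nu> = null_measure N"
    by (simp add: upper_variation_def null_measure_def)
  then show ?thesis by (simp add: integral_null_measure)
qed

lemma complex_measure_integral_finite_measure:
  assumes "finite_measure N"
  shows "complex_measure_integral N (\<lambda>E. of_real (measure N E)) f = integral\<^sup>L N f"
  by (simp add: complex_measure_integral_def signed_integral_def
      upper_variation_finite_measure[OF assms] integral_null_upper_variation)

end

theory Submission
  imports Defs
begin

text \<open>
  The Fourier coefficients of a complex measure are bounded by its total variation. Since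
  \<open>w\<close> tends to 0, the weighted summability condition admits an unbounded sequence: put
  \<open>a = 2^k\<close> at sparse positions \<open>r k\<close> with \<open>w (r k) \<le> 8^(-k)\<close>, and a rapidly decaying positive
  value everywhere else.
\<close>

lemma space_upper_variation [simp]: "space (upper_variation M \<nu>) = space M"
  by (simp add: upper_variation_def space_measure_of_conv)

lemma space_circle_borel [simp]: "space circle_borel = sphere 0 1"
  by (simp add: circle_borel_def space_restrict_space)

text \<open>
  Finiteness of \<open>N\<close> is not an issue: if \<open>N\<close> is infinite, then \<open>f\<close> is not integrable and both sides are 0.
\<close>

lemma norm_integral_unimodular_le:
  fixes f :: "'a \<Rightarrow> complex"
  assumes "\<And>x. x \<in> space N \<Longrightarrow> norm (f x) = 1"
  shows "norm (integral\<^sup>L N f) \<le> measure N (space N)"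
proof -
  have "norm (integral\<^sup>L N f) \<le> (\<integral>x. norm (f x) \<partial>N)"
    by (rule integral_norm_bound)
  also have "\<dots> = (\<integral>x. 1 \<partial>N)"
    using assms by (intro Bochner_Integration.integral_cong) auto
  finally show ?thesis by simp
qed

lemma norm_signed_integral_unimodular_le:
  fixes f :: "'a \<Rightarrow> complex"
  assumes "\<And>x. x \<in> space M \<Longrightarrow> norm (f x) = 1"
  shows "norm (signed_integral M \<nu> f) \<le>
    measure (upper_variation M \<nu>) (space M) + measure (upper_variation M (\<lambda>E. - \<nu> E)) (space M)"
  unfolding signed_integral_def
  using norm_integral_unimodular_le[of "upper_variation M \<nu>" f]
    norm_integral_unimodular_le[of "upper_variation M (\<lambda>E. - \<nu> E)" f] assms
  by (intro norm_triangle_le_diff) auto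

text \<open>The characters have modulus 1 on the circle, so the masses of the upper and lower
  variations of the real and imaginary parts of \<open>\<mu>\<close> give a bound uniform in
  \<open>n\<close>.\<close>

lemma fourier_coeff_bounded: "\<exists>B. \<forall>n. norm (fourier_coeff \<mu> n) \<le> B"
proof -
  have unimodular: "norm (cnj \<zeta> powi n) = 1" if "\<zeta> \<in> space circle_borel" for \<zeta> n
    using that by (simp add: norm_power_int)
  define V where "V \<nu> = measure (upper_variation circle_borel \<nu>) (space circle_borel) +
    measure (upper_variation circle_borel (\<lambda>E. - \<nu> E)) (space circle_borel)" for \<nu>
  have V: "norm (signed_integral circle_borel \<nu> (\<lambda>\<zeta>. cnj \<zeta> powi n)) \<le> V \<nu>" for \<nu> n
    unfolding V_def by (intro norm_signed_integral_unimodular_le unimodular)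
  have "norm (fourier_coeff \<mu> n) \<le> V (\<lambda>E. Re (\<mu> E)) + V (\<lambda>E. Im (\<mu> E))" for n
    unfolding fourier_coeff_def complex_measure_integral_def
    by (rule norm_triangle_le) (simp add: norm_mult add_mono V)
  then show ?thesis
    by blast
qed

lemma strict_mono_rapidly_null_subsequence:
  fixes w :: "nat \<Rightarrow> real" and e :: "nat \<Rightarrow> real"
  assumes "w \<longlonglongrightarrow> 0" and "\<And>k. 0 < e k"
  obtains r where "strict_mono r" and "\<And>k. \<bar>w (r k)\<bar> < e k"
proof -
  have "\<forall>k. \<exists>N. \<forall>n\<ge>N. \<bar>w n\<bar> < e k"
    using LIMSEQ_D[OF assms(1) assms(2)] by simp
  then obtain g where g: "\<And>k n. n \<ge> g k \<Longrightarrow> \<bar>w n\<bar> < e k"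
    by metis
  \<comment> \<open>The sum puts \<open>r k\<close> beyond the threshold \<open>g k\<close>; the
    summand \<open>k\<close> makes the growth strict.\<close>
  define r where "r k = k + (\<Sum>i\<le>k. g i)" for k
  have "strict_mono r"
    by (simp add: strict_mono_Suc_iff r_def)
  moreover have "g k \<le> r k" for k
    unfolding r_def by (simp add: member_le_sum trans_le_add2)
  ultimately show ?thesis
    using g that by blast
qed

text \<open>Since \<open>to_nat\<close> is injective, this is a subseries of the geometric series.
  On the integers it supplies a summable family of positive numbers.\<close>

lemma summable_on_geometric_to_nat:
  "(\<lambda>n::'a::countable. (1/2::real) ^ to_nat n) summable_on UNIV"
proof -
  have "(\<lambda>k. (1/2::real) ^ k) summable_on range (to_nat :: 'a \<Rightarrow> nat)"
    by (rule summable_on_subset_banach[OF summable_nonneg_imp_summable_on]) auto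
  then show ?thesis
    by (subst (asm) summable_on_reindex) (auto simp: o_def)
qed

text \<open>Summability is checked separately on the sparse positions, where the decay of
  \<open>w\<close> beats the growth of \<open>a\<close>, and on their complement, where
  \<open>a\<close> decays and \<open>w\<close> is merely bounded.\<close>

lemma exists_unbounded_weighted_square_summable:
  fixes w :: "nat \<Rightarrow> real"
  assumes pos: "\<And>n. 0 < w n" and null: "w \<longlonglongrightarrow> 0"
  obtains a :: "int \<Rightarrow> real"
  where "\<And>n. 0 < a n" and "(\<lambda>n. (a n)\<^sup>2 * w (nat \<bar>n\<bar>)) summable_on UNIV"
    and "\<And>B. \<exists>n. B < a n"
proof -
  \<comment> \<open>The ratio 1/8 is chosen so that squaring \<open>2 ^ k\<close> still leaves
    \<open>4 ^ k * (1/8) ^ k = (1/2) ^ k\<close>.\<close>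
  obtain r where r: "strict_mono r" "\<And>k. \<bar>w (r k)\<bar> < (1/8) ^ k"
    using strict_mono_rapidly_null_subsequence[OF null, of "\<lambda>k. (1/8) ^ k"] by auto
  obtain C where C: "\<And>n. w n \<le> C"
    using convergent_imp_Bseq[OF convergentI[OF null]] by (auto simp: Bseq_def abs_le_iff)
  define p where "p = int \<circ> r"
  have inj: "inj p"
    using strict_mono_imp_inj_on[OF r(1)] by (auto simp: p_def inj_def)
  \<comment> \<open>By injectivity \<open>inv p\<close> recovers \<open>k\<close> from
    \<open>p k\<close>. All negative indices lie outside \<open>range p\<close> and get the
    geometric filler, which keeps \<open>a\<close> positive.\<close>
  define a :: "int \<Rightarrow> real" where
    "a n = (if n \<in> range p then 2 ^ inv p n else (1/2) ^ to_nat n)" for n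
  let ?f = "\<lambda>n::int. (a n)\<^sup>2 * w (nat \<bar>n\<bar>)"
  have a_p: "a (p k) = 2 ^ k" for k
    by (simp add: a_def inj)
  have "?f (p k) \<le> (1/2) ^ k" for k
  proof -
    have "?f (p k) = (2 ^ k)\<^sup>2 * w (r k)"
      unfolding a_p by (simp add: p_def)
    also have "\<dots> \<le> (2 ^ k)\<^sup>2 * (1/8) ^ k"
      using r(2)[of k] by (intro mult_left_mono) auto
    also have "\<dots> = (2\<^sup>2 * (1/8)) ^ k"
      by (simp only: power_mult_distrib power_mult[symmetric] mult.commute[of k])
    finally show ?thesis
      by simp
  qed
  then have "(?f \<circ> p) summable_on UNIV"
    by (intro summable_on_comparison_test[OF
          summable_nonneg_imp_summable_on[where f = "\<lambda>k. (1/2::real) ^ k"]])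
      (use pos in \<open>auto simp: less_imp_le\<close>)
  then have "?f summable_on range p"
    by (simp add: summable_on_reindex inj)
  moreover have "?f summable_on (- range p)"
  proof (rule summable_on_comparison_test)
    show "(\<lambda>n. (1/2) ^ to_nat n * C) summable_on (- range p)"
      by (intro summable_on_cmult_left summable_on_subset_banach[OF summable_on_geometric_to_nat])
        auto
    show "?f n \<le> (1/2) ^ to_nat n * C" if "n \<in> - range p" for n
    proof (rule mult_mono)
      \<comment> \<open>Squaring does not increase a number in the unit interval.\<close>
      have "((1/2) ^ to_nat n)\<^sup>2 \<le> (1/2::real) ^ to_nat n"
        by (simp add: power2_eq_square mult_left_le power_le_one)
      with that show "(a n)\<^sup>2 \<le> (1/2) ^ to_nat n"
        by (simp add: a_def)
    qed (use C pos in \<open>auto simp: less_imp_le\<close>)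
  qed (use pos in \<open>auto simp: less_imp_le\<close>)
  ultimately have "?f summable_on (range p \<union> - range p)"
    by (rule summable_on_Un_disjoint) auto
  then have "?f summable_on UNIV"
    by simp
  moreover have "\<exists>n. B < a n" for B
  proof -
    obtain k where "B < 2 ^ k"
      using real_arch_pow[of 2 B] by auto
    then show ?thesis
      by (intro exI[of _ "p k"]) (simp add: a_p)
  qed
  moreover have "0 < a n" for n
    by (simp add: a_def)
  ultimately show ?thesis
    using that by blast
qed

theorem theorem1p2:
  fixes w :: "nat \<Rightarrow> real"
  assumes "\<And>n. 0 < w n" and "decseq w" and "w \<longlonglongrightarrow> 0"
  shows "\<exists>a::int \<Rightarrow> real.
           (\<forall>n. 0 < a n) \<and>
           (\<lambda>n. (a n)\<^sup>2 * w (nat \<bar>n\<bar>)) summable_on UNIV \<and>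
           \<not> (\<exists>\<mu>. complex_measure circle_borel \<mu> \<and>
                  (\<forall>n. fourier_coeff \<mu> n = complex_of_real (a n)))"
proof -
  obtain a :: "int \<Rightarrow> real" where a: "\<And>n. 0 < a n"
      "(\<lambda>n. (a n)\<^sup>2 * w (nat \<bar>n\<bar>)) summable_on UNIV" "\<And>B. \<exists>n. B < a n"
    using exists_unbounded_weighted_square_summable[OF assms(1,3)] by blast
  have False if "\<And>n. fourier_coeff \<mu> n = complex_of_real (a n)" for \<mu>
  proof -
    \<comment> \<open>Here \<open>B\<close> depends on \<open>\<mu>\<close>, but \<open>a\<close>
      exceeds every constant, so a single \<open>a\<close> excludes all measures at once.\<close>
    obtain B where "norm (fourier_coeff \<mu> n) \<le> B" for n
      using fourier_coeff_bounded by blast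
    then have "\<bar>a n\<bar> \<le> B" for n
      by (simp add: that)
    then show False
      using a(3)[of B] by (meson abs_le_D1 not_le)
  qed
  with a(1,2) show ?thesis
    by blast
qed

end
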